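(* Let $\mathbf{X}$ be a $d$-dimensional continuous random vector with probability density function $f_{\mathbf{X}}$. Let $\mathbf{X}_{fp}$ be the componentwise floating-point quantization of $\mathbf{X}$, let $\bm\Delta(\mathbf{x})$ be the volume of the quantization bin containing $\mathbf{x}$, and let $g$ be the piecewise-uniform density with the same bin probabilities as $f_{\mathbf{X}}$ (all defined in the context). Then $$H(\mathbf{X}_{fp}) = h(\mathbf{X}) - \mathbb{E}[\log \bm\Delta(\mathbf{X})] + D(f_{\mathbf{X}}\|g),$$ where $H(\mathbf{X}_{fp})=-\sum_{\mathbf{i}} p_{\mathbf{i}}\log p_{\mathbf{i}}$ is the discrete entropy, $h(\mathbf{X})$ is the differential entropy, and $D(f_{\mathbf{X}}\|g)$ is the Kullback-Leibler divergence, the integrals being taken over the granular region $\mathbb{U}^d$ as specified in the context.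
   Context: All logarithms are base 2, and $0\log 0=0$. The floating-point format has precision $p\ge 1$ and $E\ge 0$ exponent bits ($p$, $E$ integers). Let $e_{min}=-(2^{E-1}-1)$ and $e_{max}=2^{E-1}$. The representable values $u_1<u_2<\dots<u_K$, $K=2^{E+p}$, are the numbers $\pm 2^{e}(1+m2^{-(p-1)})$ with $e\in\{e_{min},e_{min}+1,\dots,e_{max}\}$ ($2^E$ exponent values) and $m\in\{0,1,\dots,2^{p-1}-1\}$. The granular region is $\mathbb{U}=[-2^{e_{max}+1}+2^{e_{max}-p},\,2^{e_{max}+1}-2^{e_{max}-p}]$. Bin boundaries: $a_1=-2^{e_{max}+1}+2^{e_{max}-p}$, $a_i=\frac{u_i+u_{i-1}}{2}$ for $2\le i\le K$; $b_i=\frac{u_{i+1}+u_i}{2}$ for $1\le i\le K-1$, $b_K=2^{e_{max}+1}-2^{e_{max}-p}$. For a multi-index $\mathbf{i}=(i_1,\dots,i_d)\in\{1,\dots,K\}^d$, the quantization bin is $B_{\mathbf{i}}=\prod_{j=1}^d[a_{i_j},b_{i_j}]$, with volume $|B_{\mathbf{i}}|$; the bins cover $\mathbb{U}^d$ and overlap only on null sets. The quantized vector $\mathbf{X}_{fp}$ takes the value $\mathbf{u}_{\mathbf{i}}=(u_{i_1},\dots,u_{i_d})$ on the bin $B_{\mathbf{i}}$, and its probabilities are $p_{\mathbf{i}}=\mathbb{P}\{\mathbf{X}\in B_{\mathbf{i}}\}=\mathbb{P}\{\mathbf{X}_{fp}=\mathbf{u}_{\mathbf{i}}\}$. For $\mathbf{x}\in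 B_{\mathbf{i}}$, $\bm\Delta(\mathbf{x})=|B_{\mathbf{i}}|$ (the product of the one-dimensional bin widths); $\bm\Delta$ is defined on $\mathbb{U}^d$. The piecewise-uniform density is $g(\mathbf{x})=\sum_{\mathbf{i}}\frac{p_{\mathbf{i}}}{|B_{\mathbf{i}}|}\mathbf{1}_{\{\mathbf{x}\in B_{\mathbf{i}}\}}$, which is constant on each bin. The integral terms are $h(\mathbf{X})=-\int_{\mathbb{U}^d} f_{\mathbf{X}}\log f_{\mathbf{X}}\,d\mathbf{x}$, $\mathbb{E}[\log\bm\Delta(\mathbf{X})]=\int_{\mathbb{U}^d} f_{\mathbf{X}}\log\bm\Delta\,d\mathbf{x}=\sum_{\mathbf{i}}p_{\mathbf{i}}\log|B_{\mathbf{i}}|$ and $D(f_{\mathbf{X}}\|g)=\int_{\mathbb{U}^d} f_{\mathbf{X}}\log\frac{f_{\mathbf{X}}}{g}\,d\mathbf{x}=-h(\mathbf{X})-\int_{\mathbb{U}^d} f_{\mathbf{X}}\log g\,d\mathbf{x}$. *)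

theory Defs
  imports "HOL-Probability.Probability"
begin

text \<open>
  The format has precision \<open>p \<ge> 1\<close> and \<open>E\<close> exponent bits. Exponents are real numbers, because for
  \<open>E = 0\<close> both extreme exponents equal \<open>1/2\<close>.
\<close>

definition fp_emin :: "nat \<Rightarrow> real" where
  "fp_emin E = - (2 powr (real E - 1) - 1)"

definition fp_emax :: "nat \<Rightarrow> real" where
  "fp_emax E = 2 powr (real E - 1)"

definition fp_exponents :: "nat \<Rightarrow> real set" where
  "fp_exponents E = {e. \<exists>k::nat. e = fp_emin E + real k \<and> e \<le> fp_emax E}"

definition fp_values :: "nat \<Rightarrow> nat \<Rightarrow> real set" where
  "fp_values p E =
     {s * 2 powr e * (1 + real m * 2 powr (- (real p - 1))) | s e m.
        s \<in> {1, -1} \<and> e \<in> fp_exponents E \<and> m \<in> {0..<2 ^ (p - 1)}}"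

definition fp_K :: "nat \<Rightarrow> nat \<Rightarrow> nat" where
  "fp_K p E = 2 ^ (E + p)"

lemma fp_exponents_eq: "fp_exponents E = (\<lambda>k. fp_emin E + real k) ` {0..<2 ^ E}"
proof -
  have 1: "fp_emax E = fp_emin E + (2 ^ E - 1)"
    by (simp add: fp_emax_def fp_emin_def powr_diff powr_realpow)
  have 2: "real k \<le> 2 ^ E - 1 \<longleftrightarrow> k < 2 ^ E" for k :: nat
  proof -
    have "real k \<le> 2 ^ E - 1 \<longleftrightarrow> real (k + 1) \<le> real (2 ^ E)" by auto
    also have "\<dots> \<longleftrightarrow> k < 2 ^ E" unfolding of_nat_le_iff by auto
    finally show ?thesis .
  qed
  show ?thesis unfolding fp_exponents_def 1 by (auto simp: 2)
qed

lemma card_fp_values: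
  assumes "p \<ge> 1"
  shows "finite (fp_values p E)" and "card (fp_values p E) = fp_K p E"
proof -
  define F where "F = (\<lambda>(s::real, k::nat, m::nat).
    s * 2 powr (fp_emin E + real k) * (1 + real m * 2 powr (- (real p - 1))))"
  define D where "D = {1, -1::real} \<times> {0..<2 ^ E::nat} \<times> {0..<2 ^ (p - 1)::nat}"
  have eq: "fp_values p E = F ` D"
  proof (intro equalityI subsetI)
    fix x assume "x \<in> fp_values p E"
    then obtain s k m where "x = s * 2 powr (fp_emin E + real k) * (1 + real m * 2 powr (- (real p - 1)))"
      and "s \<in> {1, -1}" "k \<in> {0..<2 ^ E}" "m \<in> {0..<2 ^ (p - 1)}"
      unfolding fp_values_def fp_exponents_eq by blast
    then have "x = F (s, k, m)" "(s, k, m) \<in> D" by (simp_all add: F_def D_def)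
    then show "x \<in> F ` D" by blast
  next
    fix x assume "x \<in> F ` D"
    then obtain s k m where *: "x = F (s, k, m)" "(s, k, m) \<in> D" by auto
    have "x = s * 2 powr (fp_emin E + real k) * (1 + real m * 2 powr (- (real p - 1)))"
      using * by (simp add: F_def)
    moreover have "s \<in> {1, -1}" "k \<in> {0..<2 ^ E}" "m \<in> {0..<2 ^ (p - 1)}"
      using * unfolding D_def by blast+
    ultimately show "x \<in> fp_values p E"
      unfolding fp_values_def fp_exponents_eq by blast
  qed
  define t where "t = (\<lambda>m::nat. 1 + real m * 2 powr (- (real p - 1)))"
  have t: "1 \<le> t m" "t m < 2" if "m < 2 ^ (p - 1)" for m
  proof -
    have "real m < 2 powr (real p - 1)"
    proof -
      have "real m < real (2 ^ (p - 1))" using that by (simp only: of_nat_less_iff)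
      also have "\<dots> = 2 powr (real p - 1)" using assms by (simp add: powr_realpow[symmetric] of_nat_diff)
      finally show ?thesis .
    qed
    then show "t m < 2" by (simp add: t_def powr_diff field_simps)
    show "1 \<le> t m" by (simp add: t_def)
  qed
  have less: "2 powr (c + real k) * x < 2 powr (c + real k') * y"
    if "k < k'" "x < 2" "1 \<le> y" for k k' :: nat and c x y :: real
  proof -
    have "2 powr (c + real k) * x < 2 powr (c + real k) * 2" using that by simp
    also have "\<dots> = 2 powr (c + real k + 1)" by (simp add: powr_add)
    also have "\<dots> \<le> 2 powr (c + real k')" using that by simp
    also have "\<dots> \<le> 2 powr (c + real k') * y" using that by simp
    finally show ?thesis .
  qed
  have inj: "inj_on F D"
  proof (rule inj_onI)
    fix z z' assume z: "z \<in> D" "z' \<in> D" and e: "F z = F z'"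
    obtain s k m where zz: "z = (s, k, m)" by (cases z) auto
    obtain s' k' m' where zz': "z' = (s', k', m')" by (cases z') auto
    let ?w = "2 powr (fp_emin E + real k) * t m" and ?w' = "2 powr (fp_emin E + real k') * t m'"
    have m: "m < 2 ^ (p - 1)" "m' < 2 ^ (p - 1)" and s: "s \<in> {1, -1}" "s' \<in> {1, -1}"
      using z by (auto simp: zz zz' D_def)
    have e: "s * ?w = s' * ?w'" using e by (simp add: zz zz' F_def t_def mult.assoc)
    have pos: "0 < ?w" "0 < ?w'" using t(1)[OF m(1)] t(1)[OF m(2)] by auto
    then have ss: "s = s'" using s e by (auto simp del: mult_pos_pos)
    then have w: "?w = ?w'" using s e by auto
    have "k = k'"
      using less[of k k' "t m" "t m'" "fp_emin E"] less[of k' k "t m'" "t m" "fp_emin E"] t[OF m(1)] t[OF m(2)] w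
      by (metis less_irrefl linorder_neqE_nat)
    moreover from this w have "m = m'" by (simp add: t_def)
    ultimately show "z = z'" using ss by (simp add: zz zz')
  qed
  have "card D = fp_K p E"
    using assms by (cases p) (simp_all add: D_def card_cartesian_product fp_K_def power_add)
  with inj eq show "card (fp_values p E) = fp_K p E" by (simp add: card_image)
  show "finite (fp_values p E)" unfolding eq D_def by simp
qed

text \<open>The values, bins and bin boundaries are numbered from 1 to \<open>K\<close>; lists are indexed from 0.\<close>

definition fp_u :: "nat \<Rightarrow> nat \<Rightarrow> nat \<Rightarrow> real" where
  "fp_u p E i = sorted_list_of_set (fp_values p E) ! (i - 1)"

definition fp_bound :: "nat \<Rightarrow> nat \<Rightarrow> real" where
  "fp_bound p E = 2 powr (fp_emax E + 1) - 2 powr (fp_emax E - real p)"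

definition fp_a :: "nat \<Rightarrow> nat \<Rightarrow> nat \<Rightarrow> real" where
  "fp_a p E i = (if i = 1 then - fp_bound p E else (fp_u p E i + fp_u p E (i - 1)) / 2)"

definition fp_b :: "nat \<Rightarrow> nat \<Rightarrow> nat \<Rightarrow> real" where
  "fp_b p E i = (if i = fp_K p E then fp_bound p E else (fp_u p E (i + 1) + fp_u p E i) / 2)"

definition fp_granular :: "nat \<Rightarrow> nat \<Rightarrow> real set" where
  "fp_granular p E = {- fp_bound p E .. fp_bound p E}"

definition fp_granular_vec :: "nat \<Rightarrow> nat \<Rightarrow> (real ^ 'd) set" where
  "fp_granular_vec p E = {x. \<forall>j. x $ j \<in> fp_granular p E}"

text \<open>
  Neighbouring closed bins share an endpoint. Where a single bin has to be chosen (for the quantizer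
  and for the bin volume at a point) the lower one is taken; this only matters on a null set.
\<close>

definition fp_index :: "nat \<Rightarrow> nat \<Rightarrow> real \<Rightarrow> nat" where
  "fp_index p E x = (LEAST i. i \<in> {1..fp_K p E} \<and> x \<in> {fp_a p E i .. fp_b p E i})"

text \<open>
  The quantizer is specified on the granular region only, so it is a partial function; no
  representable value is assigned outside that region.
\<close>

definition fp_quantize :: "nat \<Rightarrow> nat \<Rightarrow> real \<Rightarrow> real option" where
  "fp_quantize p E x =
     (if x \<in> fp_granular p E then Some (fp_u p E (fp_index p E x)) else None)"

definition fp_quantize_vec :: "nat \<Rightarrow> nat \<Rightarrow> real ^ 'd \<Rightarrow> real option ^ 'd" where
  "fp_quantize_vec p E x = (\<chi> j. fp_quantize p E (x $ j))"

definition fp_multi_indices :: "nat \<Rightarrow> nat \<Rightarrow> (nat ^ 'd) set" where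
  "fp_multi_indices p E = {i. \<forall>j. i $ j \<in> {1..fp_K p E}}"

definition fp_bin :: "nat \<Rightarrow> nat \<Rightarrow> nat ^ 'd \<Rightarrow> (real ^ 'd) set" where
  "fp_bin p E i = {x. \<forall>j. x $ j \<in> {fp_a p E (i $ j) .. fp_b p E (i $ j)}}"

definition fp_bin_volume :: "nat \<Rightarrow> nat \<Rightarrow> nat ^ 'd \<Rightarrow> real" where
  "fp_bin_volume p E i = measure lborel (fp_bin p E i)"

definition fp_Delta :: "nat \<Rightarrow> nat \<Rightarrow> real ^ 'd \<Rightarrow> real" where
  "fp_Delta p E x = fp_bin_volume p E (\<chi> j. fp_index p E (x $ j))"

definition fp_bin_prob :: "'a measure \<Rightarrow> ('a \<Rightarrow> real ^ 'd) \<Rightarrow> nat \<Rightarrow> nat \<Rightarrow> nat ^ 'd \<Rightarrow> real" where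
  "fp_bin_prob M X p E i = measure M {\<omega> \<in> space M. X \<omega> \<in> fp_bin p E i}"

definition fp_g :: "'a measure \<Rightarrow> ('a \<Rightarrow> real ^ 'd) \<Rightarrow> nat \<Rightarrow> nat \<Rightarrow> real ^ 'd \<Rightarrow> real" where
  "fp_g M X p E x =
     (\<Sum>i\<in>fp_multi_indices p E.
        fp_bin_prob M X p E i / fp_bin_volume p E i * indicator (fp_bin p E i) x)"

text \<open>
  Entropy of a quantized vector \<open>Y\<close>, summed over the representable vectors. Since \<open>log 2 0\<close> is
  multiplied by \<open>0\<close>, the convention \<open>0 log 0 = 0\<close> holds here and below.
\<close>

definition fp_entropy :: "'a measure \<Rightarrow> ('a \<Rightarrow> real option ^ 'd) \<Rightarrow> nat \<Rightarrow> nat \<Rightarrow> real" where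
  "fp_entropy M Y p E =
     - (\<Sum>i\<in>fp_multi_indices p E.
          let q = measure M {\<omega> \<in> space M. Y \<omega> = (\<chi> j. Some (fp_u p E (i $ j)))}
          in q * log 2 q)"

definition diff_entropy_on :: "'b::euclidean_space set \<Rightarrow> ('b \<Rightarrow> real) \<Rightarrow> real" where
  "diff_entropy_on S f = - (LINT x:S|lborel. f x * log 2 (f x))"

definition KL_on :: "'b::euclidean_space set \<Rightarrow> ('b \<Rightarrow> real) \<Rightarrow> ('b \<Rightarrow> real) \<Rightarrow> real" where
  "KL_on S f g = (LINT x:S|lborel. f x * log 2 (f x / g x))"

end

theory Submission
  imports Defs
begin

text \<open>
  Almost every point of the granular region lies in exactly one bin, so the integrals of
  \<open>f log \<Delta>\<close> and of \<open>f log g\<close> are finite sums over the bins, in which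
  \<open>g = p\<^sub>i / |B\<^sub>i|\<close> makes the terms \<open>p\<^sub>i log |B\<^sub>i|\<close> cancel. Where \<open>p\<^sub>i = 0\<close> the density \<open>f\<close>
  vanishes almost everywhere on the bin, so that \<open>log (f / g) = log f - log g\<close> is needed only
  where both \<open>f\<close> and \<open>g\<close> are positive.
\<close>

section \<open>Order of the representable values and of the bin boundaries\<close>

text \<open>With \<open>t = 2 powr (- real p)\<close>, the largest mantissa is
  \<open>2 - 2 * t\<close>, while the bound is \<open>2 powr fp_emax E * (2 - t)\<close>, half a
  spacing further out. Strictness is what gives the two outermost bins positive length.\<close>

lemma fp_values_abs_less_bound:
  assumes "p \<ge> 1" "v \<in> fp_values p E"
  shows "\<bar>v\<bar> < fp_bound p E"
proof -
  obtain s e m where v: "v = s * 2 powr e * (1 + real m * 2 powr (- (real p - 1)))"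
    and s: "s \<in> {1, -1}" and e: "e \<in> fp_exponents E" and m: "m < 2 ^ (p - 1)"
    using assms(2) unfolding fp_values_def by auto
  define t where "t = 2 powr (- real p)"
  have t: "0 < t" by (simp add: t_def)
  have "real m + 1 \<le> 2 ^ (p - 1)"
  proof -
    have "real (m + 1) \<le> real (2 ^ (p - 1))" using m by (subst of_nat_le_iff) simp
    then show ?thesis by simp
  qed
  \<comment> \<open>\<open>2 * t\<close> is the mantissa spacing, the reciprocal of the number of
    mantissas.\<close>
  moreover have "2 ^ (p - 1) * (2 * t) = 1"
    using assms(1)
    by (simp add: t_def powr_minus powr_realpow field_simps flip: power_Suc)
  ultimately have "(real m + 1) * (2 * t) \<le> 1"
    using t by (metis mult_right_mono less_imp_le mult_pos_pos zero_less_numeral)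
  then have mt: "1 + real m * (2 * t) \<le> 2 - 2 * t" by (simp add: algebra_simps)
  have pe: "2 powr (- (real p - 1)) = 2 * t"
    by (simp add: t_def powr_diff powr_minus field_simps)
  have "\<bar>v\<bar> = 2 powr e * (1 + real m * (2 * t))"
    using s t unfolding v pe by (auto simp: abs_mult)
  also have "\<dots> \<le> 2 powr fp_emax E * (2 - 2 * t)"
    using e mt t by (intro mult_mono) (auto simp: fp_exponents_def)
  also have "\<dots> < 2 powr fp_emax E * (2 - t)" using t by simp
  also have "\<dots> = fp_bound p E"
    by (simp add: fp_bound_def t_def powr_add powr_diff powr_minus field_simps)
  finally show ?thesis .
qed

lemma fp_u_in_values:
  assumes "p \<ge> 1" "i \<in> {1..fp_K p E}"
  shows "fp_u p E i \<in> fp_values p E"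
proof -
  have "i - 1 < length (sorted_list_of_set (fp_values p E))"
    using assms card_fp_values[OF assms(1)] by auto
  from nth_mem[OF this] show ?thesis
    using card_fp_values(1)[OF assms(1)] by (simp add: fp_u_def)
qed

lemma fp_u_strict_mono:
  assumes "p \<ge> 1" "1 \<le> i" "i < j" "j \<le> fp_K p E"
  shows "fp_u p E i < fp_u p E j"
  unfolding fp_u_def
  by (rule sorted_wrt_nth_less[OF strict_sorted_list_of_set])
     (use assms card_fp_values[OF assms(1)] in auto)

lemma fp_u_inj:
  assumes "p \<ge> 1" "i \<in> {1..fp_K p E}" "j \<in> {1..fp_K p E}" "fp_u p E i = fp_u p E j"
  shows "i = j"
  using fp_u_strict_mono[of p i j E] fp_u_strict_mono[of p j i E] assms
  by (cases i j rule: linorder_cases) auto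

text \<open>An interior boundary is a midpoint of two distinct values; for \<open>i = 1\<close> the
  boundary is the end of the granular region, which lies strictly beyond every value.\<close>

lemma fp_a_less_u:
  assumes "p \<ge> 1" "i \<in> {1..fp_K p E}"
  shows "fp_a p E i < fp_u p E i"
  using fp_values_abs_less_bound[OF assms(1) fp_u_in_values[OF assms]]
    fp_u_strict_mono[of p "i - 1" i E] assms
  by (auto simp: fp_a_def)

lemma fp_u_less_b:
  assumes "p \<ge> 1" "i \<in> {1..fp_K p E}"
  shows "fp_u p E i < fp_b p E i"
  using fp_values_abs_less_bound[OF assms(1) fp_u_in_values[OF assms]]
    fp_u_strict_mono[of p i "i + 1" E] assms
  by (auto simp: fp_b_def)

lemma fp_a_Suc: "1 \<le> i \<Longrightarrow> i < fp_K p E \<Longrightarrow> fp_a p E (Suc i) = fp_b p E i"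
  by (simp add: fp_a_def fp_b_def)

text \<open>Since \<open>i < j\<close>, both boundaries are midpoints, of \<open>u\<close> at
  \<open>i, i + 1\<close> and at \<open>j - 1, j\<close>; these indices are ordered pairwise, hence
  so are the midpoints.\<close>

lemma fp_b_le_a:
  assumes "p \<ge> 1" "1 \<le> i" "i < j" "j \<le> fp_K p E"
  shows "fp_b p E i \<le> fp_a p E j"
proof -
  have "i \<le> j - 1" "j - 1 < fp_K p E" using assms by auto
  then have "fp_u p E i \<le> fp_u p E (j - 1)" "fp_u p E (i + 1) \<le> fp_u p E j"
    using fp_u_strict_mono[of p i "j - 1" E] fp_u_strict_mono[of p "i + 1" j E] assms
    by (cases "i = j - 1"; force)+
  then show ?thesis using assms by (simp add: fp_a_def fp_b_def)
qed

text \<open>The last bin ends exactly at the bound, and every earlier bin ends before the last one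
  starts.\<close>

lemma fp_b_le_bound:
  assumes "p \<ge> 1" "i \<in> {1..fp_K p E}"
  shows "fp_b p E i \<le> fp_bound p E"
proof (cases "i = fp_K p E")
  case False
  have K: "fp_K p E \<in> {1..fp_K p E}" by (simp add: fp_K_def)
  have "fp_b p E i \<le> fp_a p E (fp_K p E)" using assms False by (intro fp_b_le_a) auto
  also have "\<dots> < fp_b p E (fp_K p E)"
    using fp_a_less_u[OF assms(1) K] fp_u_less_b[OF assms(1) K] by simp
  finally show ?thesis by (simp add: fp_b_def)
qed (simp add: fp_b_def)

lemma fp_bound_le_a:
  assumes "p \<ge> 1" "i \<in> {1..fp_K p E}"
  shows "- fp_bound p E \<le> fp_a p E i"
proof (cases "i = 1")
  case False
  have K: "1 \<in> {1..fp_K p E}" by (simp add: fp_K_def)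
  have "fp_a p E 1 < fp_b p E 1"
    using fp_a_less_u[OF assms(1) K] fp_u_less_b[OF assms(1) K] by simp
  also have "\<dots> \<le> fp_a p E i" using assms False by (intro fp_b_le_a) auto
  finally show ?thesis by (simp add: fp_a_def)
qed (simp add: fp_a_def)

section \<open>Locating a point in a bin\<close>

text \<open>The witness is the last bin that starts at or before \<open>x\<close>: the next bin
  starts where this one ends, and by maximality it starts after \<open>x\<close>.\<close>

lemma fp_bin_exists:
  assumes "x \<in> fp_granular p E"
  shows "\<exists>i. i \<in> {1..fp_K p E} \<and> x \<in> {fp_a p E i .. fp_b p E i}"
proof -
  define S where "S = {i \<in> {1..fp_K p E}. fp_a p E i \<le> x}"
  have S: "finite S" "1 \<in> S" using assms by (auto simp: S_def fp_a_def fp_granular_def fp_K_def)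
  define i where "i = Max S"
  have "i \<in> S" unfolding i_def using S by (intro Max_in) blast+
  then have i: "i \<in> {1..fp_K p E}" "fp_a p E i \<le> x" by (auto simp: S_def)
  have "x \<le> fp_b p E i"
  proof (cases "i = fp_K p E")
    case True
    then show ?thesis using assms by (simp add: fp_b_def fp_granular_def)
  next
    case False
    have "Suc i \<notin> S" using Max_ge[OF S(1), of "Suc i"] by (auto simp: i_def)
    then have "x < fp_a p E (Suc i)" using i False by (auto simp: S_def)
    then show ?thesis using fp_a_Suc[of i p E] i False by simp
  qed
  with i show ?thesis by auto
qed

lemma
  assumes "x \<in> fp_granular p E"
  shows fp_index_in_range: "fp_index p E x \<in> {1..fp_K p E}"
    and fp_index_in_bin: "x \<in> {fp_a p E (fp_index p E x) .. fp_b p E (fp_index p E x)}"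
  using LeastI_ex[OF fp_bin_exists[OF assms]] unfolding fp_index_def by blast+

text \<open>Two distinct bins can meet only in the right endpoint of the lower one. Once
  \<open>x\<close> avoids all right endpoints, the bin containing it is unique, so the choice made
  by \<open>LEAST\<close> has no influence.\<close>

lemma fp_index_eq_iff:
  assumes "p \<ge> 1" "i \<in> {1..fp_K p E}" "\<And>k. k \<in> {1..fp_K p E} \<Longrightarrow> x \<noteq> fp_b p E k"
  shows "x \<in> {fp_a p E i .. fp_b p E i} \<longleftrightarrow> x \<in> fp_granular p E \<and> fp_index p E x = i"
proof
  assume x: "x \<in> {fp_a p E i .. fp_b p E i}"
  then have g: "x \<in> fp_granular p E"
    using fp_b_le_bound[OF assms(1,2)] fp_bound_le_a[OF assms(1,2)] by (auto simp: fp_granular_def)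
  note n = fp_index_in_range[OF g] and nx = fp_index_in_bin[OF g]
  have "fp_index p E x = i"
  proof (cases "fp_index p E x" i rule: linorder_cases)
    case less
    then show ?thesis
      using fp_b_le_a[of p "fp_index p E x" i E] n nx assms(1,2) assms(3)[OF n] x by force
  next
    case greater
    then show ?thesis
      using fp_b_le_a[of p i "fp_index p E x" E] n nx assms(1,2) assms(3)[OF assms(2)] x by force
  qed
  with g show "x \<in> fp_granular p E \<and> fp_index p E x = i" by simp
qed (use fp_index_in_bin in auto)

section \<open>Bins in several dimensions: volume, null boundaries, measurability\<close>

lemma finite_fp_multi_indices: "finite (fp_multi_indices p E :: (nat ^ 'd) set)"
proof -
  have "(fp_multi_indices p E :: (nat ^ 'd) set)
      \<subseteq> vec_lambda ` (PiE UNIV (\<lambda>_. {1..fp_K p E}))"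
  proof
    fix i :: "nat ^ 'd" assume "i \<in> fp_multi_indices p E"
    then show "i \<in> vec_lambda ` (PiE UNIV (\<lambda>_. {1..fp_K p E}))"
      by (intro image_eqI[of _ _ "vec_nth i"]) (auto simp: fp_multi_indices_def)
  qed
  then show ?thesis by (rule finite_subset) (intro finite_imageI finite_PiE, auto)
qed

lemma fp_index_vec_in_multi_indices:
  "x \<in> fp_granular_vec p E \<Longrightarrow> (\<chi> j. fp_index p E (x $ j)) \<in> fp_multi_indices p E"
  using fp_index_in_range by (auto simp: fp_multi_indices_def fp_granular_vec_def)

lemma fp_bin_eq_cbox: "fp_bin p E i = cbox (\<chi> j. fp_a p E (i $ j)) (\<chi> j. fp_b p E (i $ j))"
  by (auto simp: fp_bin_def mem_box_cart)

lemma fp_bin_sets [measurable]: "fp_bin p E i \<in> sets borel"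
  by (simp add: fp_bin_eq_cbox)

lemma fp_granular_vec_sets [measurable]: "(fp_granular_vec p E :: (real ^ 'd) set) \<in> sets borel"
proof -
  have "(fp_granular_vec p E :: (real ^ 'd) set) = cbox (\<chi> j. - fp_bound p E) (\<chi> j. fp_bound p E)"
    by (auto simp: fp_granular_vec_def fp_granular_def mem_box_cart)
  then show ?thesis by simp
qed

text \<open>Each edge of the box has positive length, because a value lies strictly between its
  endpoints. Positivity justifies the logarithm of the quotient that defines
  \<open>g\<close>.\<close>

lemma fp_bin_volume_pos:
  assumes "p \<ge> 1" "i \<in> fp_multi_indices p E"
  shows "0 < fp_bin_volume p E (i :: nat ^ 'd)"
proof -
  have ab: "fp_a p E (i $ j) < fp_b p E (i $ j)" for j
    using fp_a_less_u[OF assms(1)] fp_u_less_b[OF assms(1)] assms(2)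
    unfolding fp_multi_indices_def by (metis (no_types, lifting) mem_Collect_eq order.strict_trans)
  then have "0 < measure lborel (cbox (\<chi> j. fp_a p E (i $ j)) (\<chi> j. fp_b p E (i $ j)) :: (real ^ 'd) set)"
    by (intro content_pos_lt) (auto simp: Basis_vec_def inner_axis)
  then show ?thesis by (simp add: fp_bin_volume_def fp_bin_eq_cbox)
qed

lemma AE_lborel_component_neq: "AE x in lborel. (x :: real ^ 'd) $ j \<noteq> c"
  using AE_lborel_inner_neq[of "axis j 1 :: real ^ 'd" c]
  by (simp add: inner_axis axis_in_Basis_iff)

text \<open>The bins overlap only inside the finitely many hyperplanes on which some coordinate
  equals some right endpoint. Off this null set the closed bins are the fibres of the index map on
  the granular region.\<close>

lemma AE_fp_bin_iff:
  assumes "p \<ge> 1"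
  shows "AE x :: real ^ 'd in lborel. \<forall>i\<in>fp_multi_indices p E.
    x \<in> fp_bin p E i \<longleftrightarrow> x \<in> fp_granular_vec p E \<and> (\<chi> j. fp_index p E (x $ j)) = i"
proof -
  have "AE x :: real ^ 'd in lborel. \<forall>k\<in>{1..fp_K p E}. \<forall>j. x $ j \<noteq> fp_b p E k"
    by (intro AE_finite_allI AE_all_countable[THEN iffD2] allI AE_lborel_component_neq) auto
  then show ?thesis
  proof eventually_elim
    case (elim x)
    show ?case
    proof
      fix i :: "nat ^ 'd" assume "i \<in> fp_multi_indices p E"
      then have "x $ j \<in> {fp_a p E (i $ j) .. fp_b p E (i $ j)} \<longleftrightarrow>
          x $ j \<in> fp_granular p E \<and> fp_index p E (x $ j) = i $ j" for j
        using elim by (intro fp_index_eq_iff[OF assms]) (auto simp: fp_multi_indices_def)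
      then show "x \<in> fp_bin p E i \<longleftrightarrow>
          x \<in> fp_granular_vec p E \<and> (\<chi> j. fp_index p E (x $ j)) = i"
        by (auto simp: fp_bin_def fp_granular_vec_def vec_eq_iff)
    qed
  qed
qed

lemma measurable_fp_index [measurable]: "fp_index p E \<in> borel \<rightarrow>\<^sub>M count_space UNIV"
  unfolding fp_index_def[abs_def] by measurable

text \<open>The target is countable, so it suffices that preimages of single multi-indices are
  Borel; each is a finite intersection of conditions on the coordinates.\<close>

lemma measurable_fp_index_vec [measurable]:
  "(\<lambda>x :: real ^ 'd. \<chi> j. fp_index p E (x $ j)) \<in> borel \<rightarrow>\<^sub>M count_space UNIV"
proof -
  have nth [measurable]: "(\<lambda>x :: real ^ 'd. x $ j) \<in> borel_measurable borel" for j
    by (intro borel_measurable_continuous_onI continuous_intros)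
  have "{x :: real ^ 'd. \<forall>j. fp_index p E (x $ j) = i $ j} \<in> sets borel" for i
    by measurable
  moreover have "(\<lambda>x :: real ^ 'd. \<chi> j. fp_index p E (x $ j)) -` {i} \<inter> space borel =
      {x. \<forall>j. fp_index p E (x $ j) = i $ j}" for i
    by (auto simp: vec_eq_iff)
  ultimately show ?thesis
    by (subst measurable_count_space_eq_countable) auto
qed

text \<open>Outside the region all indicators vanish; inside, exactly one equals 1. As
  \<open>x\<close> is fixed, \<open>h\<close> may contain factors such as \<open>f x\<close>, and so
  one lemma evaluates both \<open>g\<close> and the integrands.\<close>

lemma sum_fp_bin_indicator:
  fixes h :: "nat ^ 'd \<Rightarrow> real"
  assumes "\<And>i. i \<in> fp_multi_indices p E \<Longrightarrow>
    x \<in> fp_bin p E i \<longleftrightarrow> x \<in> fp_granular_vec p E \<and> (\<chi> j. fp_index p E (x $ j)) = i"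
  shows "(\<Sum>i\<in>fp_multi_indices p E. h i * indicator (fp_bin p E i) x) =
    indicator (fp_granular_vec p E) x * h (\<chi> j. fp_index p E (x $ j))"
proof (cases "x \<in> fp_granular_vec p E")
  case True
  let ?n = "\<chi> j. fp_index p E (x $ j)"
  have "(\<Sum>i\<in>fp_multi_indices p E. h i * indicator (fp_bin p E i) x) =
      (\<Sum>i\<in>fp_multi_indices p E. if i = ?n then h i else 0)"
    using assms True by (intro sum.cong) (auto simp: indicator_def)
  also have "\<dots> = h ?n"
    using fp_index_vec_in_multi_indices[OF True] by (simp add: finite_fp_multi_indices)
  finally show ?thesis using True by simp
next
  case False
  then show ?thesis using assms by (auto simp: indicator_def intro!: sum.neutral)
qed

section \<open>Quantizer events and transfer of null sets\<close>

text \<open>Distinct indices carry distinct values, so the output determines the index; outside the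
  region some component is \<open>None\<close>, which never equals a \<open>Some\<close>.\<close>

lemma fp_quantize_vec_eq_iff:
  assumes "p \<ge> 1" "i \<in> fp_multi_indices p E"
  shows "fp_quantize_vec p E x = (\<chi> j. Some (fp_u p E (i $ j))) \<longleftrightarrow>
    x \<in> fp_granular_vec p E \<and> (\<chi> j. fp_index p E (x $ j)) = i"
proof -
  have "fp_quantize p E (x $ j) = Some (fp_u p E (i $ j)) \<longleftrightarrow>
      x $ j \<in> fp_granular p E \<and> fp_index p E (x $ j) = i $ j" for j
    using fp_u_inj[OF assms(1) fp_index_in_range, of "x $ j" E "i $ j"] assms(2)
    by (auto simp: fp_quantize_def fp_multi_indices_def)
  then show ?thesis
    by (auto simp: fp_quantize_vec_def fp_granular_vec_def vec_eq_iff)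
qed

text \<open>A law with a density is absolutely continuous, so null sets of \<open>N\<close> pull
  back to null events.\<close>

lemma distributed_AE:
  assumes "distributed M N X f" "AE x in N. P x"
  shows "AE \<omega> in M. P (X \<omega>)"
proof (rule AE_distrD[where f = X and P = P])
  show "X \<in> M \<rightarrow>\<^sub>M N" using assms(1) by (rule distributed_measurable)
  show "AE x in distr M N X. P x"
    unfolding distributed_distr_eq_density[OF assms(1)]
      AE_density[OF distributed_borel_measurable[OF assms(1)]]
    using assms(2) by eventually_elim simp
qed

section \<open>The entropy identity\<close>

theorem mainTheorem1:
  fixes M :: "'a measure" and X :: "'a \<Rightarrow> real ^ 'd" and f :: "real ^ 'd \<Rightarrow> real"
    and p E :: nat
  assumes "prob_space M"
    and "p \<ge> 1"
    and "\<And>x. 0 \<le> f x"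
    and "distributed M lborel X (\<lambda>x. ennreal (f x))"
    and "set_integrable lborel (fp_granular_vec p E) (\<lambda>x. f x * log 2 (f x))"
  shows "fp_entropy M (\<lambda>\<omega>. fp_quantize_vec p E (X \<omega>)) p E =
      diff_entropy_on (fp_granular_vec p E) f
      - (LINT x:fp_granular_vec p E|lborel. f x * log 2 (fp_Delta p E x))
      + KL_on (fp_granular_vec p E) f (fp_g M X p E)"
proof -
  interpret prob_space M by fact
  note p = \<open>p \<ge> 1\<close> and f0 = assms(3) and distr = assms(4)
  let ?U = "fp_granular_vec p E :: (real ^ 'd) set"
  let ?I = "fp_multi_indices p E :: (nat ^ 'd) set"
  let ?B = "fp_bin p E :: nat ^ 'd \<Rightarrow> _"
  let ?V = "fp_bin_volume p E :: nat ^ 'd \<Rightarrow> _"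
  let ?n = "\<lambda>x :: real ^ 'd. \<chi> j. fp_index p E (x $ j)"
  let ?g = "fp_g M X p E"
  define q where "q = fp_bin_prob M X p E"
  have X [measurable]: "X \<in> borel_measurable M"
    using distributed_measurable[OF distr] by simp
  have f [measurable]: "f \<in> borel_measurable borel"
    using distributed_real_measurable[OF _ distr] f0 by simp
  have bin: "AE x in lborel. \<forall>i\<in>?I. x \<in> ?B i \<longleftrightarrow> x \<in> ?U \<and> ?n x = i"
    by (rule AE_fp_bin_iff[OF p])
  \<comment> \<open>The test function 1 shows that the nonnegative \<open>f\<close> has total mass
    1.\<close>
  have int_f: "integrable lborel f"
    using distributed_nn_integral[OF distr, of "\<lambda>_. 1"] f0
    by (intro integrableI_nonneg) (auto simp: emeasure_space_1)
  have int_fB: "integrable lborel (\<lambda>x. f x * indicator (?B i) x)" for i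
    using integrable_mult_indicator[of "?B i" lborel f] int_f by (simp add: mult.commute)
  have q_eq: "(LINT x|lborel. f x * indicator (?B i) x) = q i" for i
  proof -
    have "(LINT x|lborel. f x * indicator (?B i) x) = (LINT \<omega>|M. indicator (?B i) (X \<omega>))"
      using distributed_integral[OF distr, of "indicator (?B i)"] f0 by simp
    also have "\<dots> = (LINT \<omega>|M. indicator {\<omega> \<in> space M. X \<omega> \<in> ?B i} \<omega>)"
      by (intro Bochner_Integration.integral_cong) (auto simp: indicator_def)
    also have "\<dots> = q i" by (simp add: q_def fp_bin_prob_def)
    finally show ?thesis .
  qed
  \<comment> \<open>A nonnegative function with integral 0 vanishes almost everywhere; finiteness of
    \<open>?I\<close> yields one null set for all bins.\<close>
  have zero: "AE x in lborel. \<forall>i\<in>?I. q i = 0 \<longrightarrow> f x * indicator (?B i) x = 0"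
  proof (intro AE_finite_allI finite_fp_multi_indices)
    fix i
    show "AE x in lborel. q i = 0 \<longrightarrow> f x * indicator (?B i) x = 0"
      using integral_nonneg_eq_0_iff_AE[OF int_fB[of i]] f0 q_eq[of i] by (cases "q i = 0") auto
  qed
  \<comment> \<open>The coefficients are left free: they become \<open>log 2 (?V i)\<close> for the
    bin volume and \<open>log 2 (q i) - log 2 (?V i)\<close> for \<open>g\<close>.\<close>
  have sums: "(LINT x|lborel. (\<Sum>i\<in>?I. c i * (f x * indicator (?B i) x))) = (\<Sum>i\<in>?I. c i * q i)"
      "integrable lborel (\<lambda>x. \<Sum>i\<in>?I. c i * (f x * indicator (?B i) x))" for c
    using int_fB by (simp_all add: q_eq)

  have entropy: "fp_entropy M (\<lambda>\<omega>. fp_quantize_vec p E (X \<omega>)) p E = - (\<Sum>i\<in>?I. q i * log 2 (q i))"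
  proof -
    have "prob {\<omega> \<in> space M. fp_quantize_vec p E (X \<omega>) = (\<chi> j. Some (fp_u p E (i $ j)))} = q i"
      if i: "i \<in> ?I" for i
      unfolding q_def fp_bin_prob_def fp_quantize_vec_eq_iff[OF p i]
    proof (rule finite_measure_eq_AE)
      \<comment> \<open>The quantizer event and the closed-bin event differ only where
        \<open>X\<close> hits the null set of shared boundaries.\<close>
      show "AE \<omega> in M. \<omega> \<in> {\<omega> \<in> space M. X \<omega> \<in> ?U \<and> ?n (X \<omega>) = i} \<longleftrightarrow>
          \<omega> \<in> {\<omega> \<in> space M. X \<omega> \<in> ?B i}"
        using distributed_AE[OF distr bin] by eventually_elim (use i in auto)
    qed measurable
    then show ?thesis by (simp add: fp_entropy_def Let_def)
  qed

  have Delta: "(LINT x:?U|lborel. f x * log 2 (fp_Delta p E x)) = (\<Sum>i\<in>?I. log 2 (?V i) * q i)"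
    unfolding set_lebesgue_integral_def sums(1)[symmetric]
  proof (rule integral_cong_AE)
    show "AE x in lborel. indicator ?U x *\<^sub>R (f x * log 2 (fp_Delta p E x)) =
        (\<Sum>i\<in>?I. log 2 (?V i) * (f x * indicator (?B i) x))"
      using bin
    proof eventually_elim
      case (elim x)
      show ?case
        using sum_fp_bin_indicator[of p E x "\<lambda>i. log 2 (?V i) * f x"] elim
        by (simp add: fp_Delta_def mult_ac)
    qed
  qed (unfold fp_Delta_def, measurable)

  have KL: "KL_on ?U f ?g =
      (LINT x:?U|lborel. f x * log 2 (f x)) - (\<Sum>i\<in>?I. (log 2 (q i) - log 2 (?V i)) * q i)"
  proof -
    have "KL_on ?U f ?g = (LINT x|lborel. indicator ?U x *\<^sub>R (f x * log 2 (f x)) -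
        (\<Sum>i\<in>?I. (log 2 (q i) - log 2 (?V i)) * (f x * indicator (?B i) x)))"
      unfolding KL_on_def set_lebesgue_integral_def
    proof (rule integral_cong_AE)
      show "AE x in lborel. indicator ?U x *\<^sub>R (f x * log 2 (f x / ?g x)) =
          indicator ?U x *\<^sub>R (f x * log 2 (f x)) -
          (\<Sum>i\<in>?I. (log 2 (q i) - log 2 (?V i)) * (f x * indicator (?B i) x))"
        using bin zero
      proof eventually_elim
        case (elim x)
        have S: "(\<Sum>i\<in>?I. (log 2 (q i) - log 2 (?V i)) * (f x * indicator (?B i) x)) =
            indicator ?U x * ((log 2 (q (?n x)) - log 2 (?V (?n x))) * f x)"
          using sum_fp_bin_indicator[of p E x "\<lambda>i. (log 2 (q i) - log 2 (?V i)) * f x"] elim(1)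
          by (simp add: mult_ac)
        have g: "?g x = indicator ?U x * (q (?n x) / ?V (?n x))"
          using sum_fp_bin_indicator[of p E x "\<lambda>i. q i / ?V i"] elim(1)
          by (simp add: fp_g_def q_def)
        show ?case
        proof (cases "x \<in> ?U \<and> f x \<noteq> 0")
          case True
          then have n: "?n x \<in> ?I" using fp_index_vec_in_multi_indices by blast
          \<comment> \<open>By \<open>bin\<close>, \<open>x\<close> lies in the bin
            \<open>?n x\<close>; were its probability 0, \<open>zero\<close> would force
            \<open>f x = 0\<close>.\<close>
          then have "q (?n x) \<noteq> 0" using elim True by fastforce
          then have "0 < q (?n x)" "0 < ?V (?n x)" "0 < f x"
            using fp_bin_volume_pos[OF p n] True f0[of x]
            by (auto simp: q_def fp_bin_prob_def less_le)
          then show ?thesis using True unfolding S g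
            by (simp add: log_divide log_mult algebra_simps)
        \<comment> \<open>In the remaining case a factor \<open>indicator ?U x\<close> or
          \<open>f x\<close> is 0, so both sides vanish whatever the logarithms are.\<close>
        qed (auto simp: S)
      qed
    qed (unfold fp_g_def, measurable)
    also have "\<dots> = (LINT x:?U|lborel. f x * log 2 (f x)) -
        (\<Sum>i\<in>?I. (log 2 (q i) - log 2 (?V i)) * q i)"
      \<comment> \<open>Integrability of \<open>f log f\<close> on the region allows the integral of
        the difference to be split.\<close>
      using assms(5) sums
      by (simp add: set_integrable_def set_lebesgue_integral_def)
    finally show ?thesis .
  qed

  \<comment> \<open>The two integrals of \<open>f log f\<close> cancel, and so do the sums of
    \<open>log 2 (?V i) * q i\<close>.\<close>
  show ?thesis
    unfolding entropy Delta KL diff_entropy_on_def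
    by (simp add: algebra_simps sum_subtractf)
qed

end
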